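(* Let $\mathcal{I}$ be an ideal on $\mathbf{N}$ such that $\mathrm{Fin}\subsetneq \mathcal{I}\subseteq \mathcal{Z}$. Then there exists an infinite real matrix $A=(a_{n,k})_{n,k\in\mathbf{N}}$ which is $(\mathcal{I},\mathcal{Z})$-regular but does not satisfy the condition $$\mathcal{Z}\text{-}\lim_n \sum_{k \in E} |a_{n,k}|=0 \quad\text{for all } E \in \mathcal{I}.$$
   Context: $\mathbf{N}$ is the set of positive integers and $\mathrm{Fin}$ is the family of finite subsets of $\mathbf{N}$. An ideal on $\mathbf{N}$ is a family of subsets of $\mathbf{N}$ closed under finite unions and under taking subsets. $\mathcal{Z}=\{S\subseteq\mathbf{N}: \lim_{n\to\infty}\frac1n|S\cap[1,n]|=0\}$ is the ideal of sets of asymptotic density zero. Let $\omega$ be the set of all real sequences indexed by $\mathbf{N}$. For an ideal $\mathcal{I}$, a sequence $x\in\omega$ is $\mathcal{I}$-convergent to $\eta\in\mathbf{R}$, written $\mathcal{I}\text{-}\lim x=\eta$ (or $\mathcal{I}\text{-}\lim_n x_n=\eta$), if $\{n\in\mathbf{N}: |x_n-\eta|>\varepsilon\}\in\mathcal{I}$ for all $\varepsilon>0$. $c(\mathcal{I})$ is the vector space of $\mathcal{I}$-convergent real sequences, and $\ell_\infty$ is the space of bounded real sequences. For an infinite real matrix $A=(a_{n,k})$ and $x\in\omega$, $Ax$ is the sequence $(\sum_k a_{n,k}x_k)_n$, which is well defined when all these series converge. For $X,Y\subseteq\omega$, $(X,Y)$ denotes the set of infinite real matrices $A$ such that $Ax$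 is well defined and belongs to $Y$ for all $x\in X$. For ideals $\mathcal{I},\mathcal{J}$, a matrix $A$ is $(\mathcal{I},\mathcal{J})$-regular if $A\in(c(\mathcal{I})\cap\ell_\infty,\,c(\mathcal{J})\cap\ell_\infty)$ and $\mathcal{I}\text{-}\lim x=\mathcal{J}\text{-}\lim Ax$ for all $x\in c(\mathcal{I})\cap\ell_\infty$. *)

theory Defs
  imports "HOL-Analysis.Analysis"
begin

text \<open>
  Sequences and matrices indexed by the positive integers are represented by functions on
  \<^typ>\<open>nat\<close>. Every notion below only inspects indices in \<open>\<nat>\<^sub>+\<close>, so the values at index \<open>0\<close> are
  irrelevant.
\<close>

abbreviation pos_nats :: "nat set"  ("\<nat>\<^sub>+") where
  "\<nat>\<^sub>+ \<equiv> {1..}"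

definition ideal_on_pos :: "nat set set \<Rightarrow> bool" where
  "ideal_on_pos \<I> \<longleftrightarrow>
     \<I> \<subseteq> Pow \<nat>\<^sub>+ \<and> {} \<in> \<I> \<and>
     (\<forall>S\<in>\<I>. \<forall>T\<in>\<I>. S \<union> T \<in> \<I>) \<and>
     (\<forall>S\<in>\<I>. \<forall>T. T \<subseteq> S \<longrightarrow> T \<in> \<I>)"

definition Fin :: "nat set set" where
  "Fin = {S. S \<subseteq> \<nat>\<^sub>+ \<and> finite S}"

definition density_zero :: "nat set set"  ("\<Z>") where
  "\<Z> = {S. S \<subseteq> \<nat>\<^sub>+ \<and> (\<lambda>n. real (card (S \<inter> {1..n})) / real n) \<longlonglongrightarrow> 0}"

definition ideal_converges :: "nat set set \<Rightarrow> (nat \<Rightarrow> real) \<Rightarrow> real \<Rightarrow> bool" where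
  "ideal_converges \<I> x \<eta> \<longleftrightarrow> (\<forall>\<epsilon>>0. {n \<in> \<nat>\<^sub>+. \<bar>x n - \<eta>\<bar> > \<epsilon>} \<in> \<I>)"

definition c_space :: "nat set set \<Rightarrow> (nat \<Rightarrow> real) set" where
  "c_space \<I> = {x. \<exists>\<eta>. ideal_converges \<I> x \<eta>}"

definition ell_infty :: "(nat \<Rightarrow> real) set" where
  "ell_infty = {x. bounded (x ` \<nat>\<^sub>+)}"

text \<open>The series start at column \<open>1\<close>, hence the shift of the summation index.\<close>

definition mat_defined :: "(nat \<Rightarrow> nat \<Rightarrow> real) \<Rightarrow> (nat \<Rightarrow> real) \<Rightarrow> bool" where
  "mat_defined A x \<longleftrightarrow> (\<forall>n\<in>\<nat>\<^sub>+. summable (\<lambda>k. A n (Suc k) * x (Suc k)))"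

definition mat_apply :: "(nat \<Rightarrow> nat \<Rightarrow> real) \<Rightarrow> (nat \<Rightarrow> real) \<Rightarrow> nat \<Rightarrow> real" where
  "mat_apply A x = (\<lambda>n. \<Sum>k. A n (Suc k) * x (Suc k))"

definition mat_class ::
    "(nat \<Rightarrow> real) set \<Rightarrow> (nat \<Rightarrow> real) set \<Rightarrow> (nat \<Rightarrow> nat \<Rightarrow> real) set" where
  "mat_class X Y = {A. \<forall>x\<in>X. mat_defined A x \<and> mat_apply A x \<in> Y}"

text \<open>
  Equality of the two limits is stated relationally: \<open>x\<close> and \<open>A x\<close> have the same limits. For
  proper ideals limits are unique, and this is ordinary equality of limits.
\<close>

definition ideal_regular ::
    "nat set set \<Rightarrow> nat set set \<Rightarrow> (nat \<Rightarrow> nat \<Rightarrow> real) \<Rightarrow> bool" where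
  "ideal_regular \<I> \<J> A \<longleftrightarrow>
     A \<in> mat_class (c_space \<I> \<inter> ell_infty) (c_space \<J> \<inter> ell_infty) \<and>
     (\<forall>x \<in> c_space \<I> \<inter> ell_infty. \<forall>\<eta>.
        ideal_converges \<I> x \<eta> \<longleftrightarrow> ideal_converges \<J> (mat_apply A x) \<eta>)"

end

theory Submission
  imports Defs "HOL-Library.Discrete_Functions"
    "HOL-Real_Asymp.Real_Asymp"
begin

text \<open>
  Let \<open>E \<in> \<I>\<close> be infinite, with increasing enumeration \<open>e\<close>. For \<open>2\<^sup>j \<le> n < 2\<^sup>j\<^sup>+\<^sup>1\<close> row \<open>n\<close> of the
  matrix is the \<open>n\<close>-th unit vector (if \<open>n \<notin> E\<close>) plus row \<open>n - 2\<^sup>j\<close> of the Walsh--Hadamard matrix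
  of order \<open>2\<^sup>j\<close>, divided by \<open>2\<^sup>j\<close> and spread over the columns \<open>e 0, \<dots>, e (2\<^sup>j - 1)\<close>. The absolute
  row sums over \<open>E\<close> are then all equal to \<open>1\<close>. On the other hand, by Parseval's identity the
  Hadamard part maps a sequence bounded by \<open>M\<close> to a sequence \<open>y\<close> with
  \<open>\<Sum>y\<^sub>n\<^sup>2 \<le> M\<^sup>2\<close> over each dyadic block, so \<open>\<bar>y\<^sub>n\<bar> > \<epsilon>\<close> happens only \<open>O(log N)\<close> times for \<open>n \<le> N\<close>.
\<close>

section \<open>Sets of density zero\<close>

lemma density_zero_subset:
  assumes "S \<in> \<Z>" "T \<subseteq> S"
  shows "T \<in> \<Z>"
proof -
  have "(\<lambda>n. real (card (T \<inter> {1..n})) / real n) \<longlonglongrightarrow> 0"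
  proof (rule tendsto_sandwich[OF _ _ tendsto_const])
    show "(\<lambda>n. real (card (S \<inter> {1..n})) / real n) \<longlonglongrightarrow> 0"
      using assms by (simp add: density_zero_def)
    show "\<forall>\<^sub>F n in sequentially. real (card (T \<inter> {1..n})) / real n
        \<le> real (card (S \<inter> {1..n})) / real n"
      using assms(2) by (intro always_eventually allI divide_right_mono)
        (auto intro!: card_mono)
  qed auto
  with assms show ?thesis by (auto simp: density_zero_def)
qed

lemma density_zero_Un:
  assumes "S \<in> \<Z>" "T \<in> \<Z>"
  shows "S \<union> T \<in> \<Z>"
proof -
  have "(\<lambda>n. real (card ((S \<union> T) \<inter> {1..n})) / real n) \<longlonglongrightarrow> 0"
  proof (rule tendsto_sandwich[OF _ _ tendsto_const])
    show "(\<lambda>n. real (card (S \<inter> {1..n})) / real n + real (card (T \<inter> {1..n})) / real n)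
        \<longlonglongrightarrow> 0"
      using assms by (auto simp: density_zero_def intro!: tendsto_add_zero)
    have "card ((S \<union> T) \<inter> {1..n}) \<le> card (S \<inter> {1..n}) + card (T \<inter> {1..n})" for n
      by (simp add: Int_Un_distrib2 card_Un_le)
    then have "real (card ((S \<union> T) \<inter> {1..n})) / real n
        \<le> real (card (S \<inter> {1..n})) / real n + real (card (T \<inter> {1..n})) / real n" for n
      by (simp flip: add_divide_distrib of_nat_add add: divide_right_mono)
    then show "\<forall>\<^sub>F n in sequentially. real (card ((S \<union> T) \<inter> {1..n})) / real n
        \<le> real (card (S \<inter> {1..n})) / real n + real (card (T \<inter> {1..n})) / real n"
      by simp
  qed auto
  with assms show ?thesis by (auto simp: density_zero_def)
qed

lemma pos_nats_not_density_zero: "\<nat>\<^sub>+ \<notin> \<Z>"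
proof
  assume "\<nat>\<^sub>+ \<in> \<Z>"
  then have "(\<lambda>n. real (card (\<nat>\<^sub>+ \<inter> {1..n})) / real n) \<longlonglongrightarrow> 0"
    by (simp add: density_zero_def)
  moreover have "\<nat>\<^sub>+ \<inter> {1..n} = {1..n}" for n :: nat
    by auto
  ultimately have "(\<lambda>n. real n / real n) \<longlonglongrightarrow> 0"
    by simp
  moreover have "(\<lambda>n. real n / real n) \<longlonglongrightarrow> 1"
    by real_asymp
  ultimately show False
    using LIMSEQ_unique by fastforce
qed

text \<open>No index can be close to both limits, so otherwise two sets of density zero would cover
  \<open>\<nat>\<^sub>+\<close>.\<close>

lemma ideal_converges_density_zero_unique:
  assumes "ideal_converges \<Z> y a" "ideal_converges \<Z> y b"
  shows "a = b"
proof (rule ccontr)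
  assume "a \<noteq> b"
  \<comment> \<open>A third of the distance gives \<open>2 * d < \<bar>a - b\<bar>\<close>, so the
    closed \<open>d\<close>-balls around \<open>a\<close> and \<open>b\<close> are disjoint.\<close>
  define d where "d = \<bar>a - b\<bar> / 3"
  have "d > 0" using \<open>a \<noteq> b\<close> by (simp add: d_def)
  then have "{n \<in> \<nat>\<^sub>+. \<bar>y n - a\<bar> > d} \<union> {n \<in> \<nat>\<^sub>+. \<bar>y n - b\<bar> > d} \<in> \<Z>"
    using assms by (intro density_zero_Un) (auto simp: ideal_converges_def)
  moreover have "\<nat>\<^sub>+ \<subseteq> {n \<in> \<nat>\<^sub>+. \<bar>y n - a\<bar> > d} \<union> {n \<in> \<nat>\<^sub>+. \<bar>y n - b\<bar> > d}"
    using \<open>d > 0\<close> unfolding d_def by (auto split: abs_split)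
  ultimately show False
    using density_zero_subset pos_nats_not_density_zero by blast
qed

section \<open>Walsh--Hadamard matrices\<close>

text \<open>Sylvester's recursion: four copies of the matrix of half the order, the lower right one
  negated. For \<open>r, i < 2 ^ j\<close> the sign is the parity of the number of binary ones
  common to \<open>r\<close> and \<open>i\<close>.\<close>

fun walsh :: "nat \<Rightarrow> nat \<Rightarrow> nat \<Rightarrow> real" where
  "walsh 0 r i = 1"
| "walsh (Suc j) r i =
     (if 2 ^ j \<le> r \<and> 2 ^ j \<le> i then - 1 else 1) * walsh j (r mod 2 ^ j) (i mod 2 ^ j)"

lemma abs_walsh [simp]: "\<bar>walsh j r i\<bar> = 1"
  by (induction j arbitrary: r i) (auto simp: abs_mult)

lemma sum_lessThan_add:
  fixes f :: "nat \<Rightarrow> 'a::comm_monoid_add"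
  shows "sum f {..<m + n} = sum f {..<m} + (\<Sum>i<n. f (m + i))"
  by (induction n) (auto simp: add.assoc)

text \<open>Induction by halving \<open>x\<close>: if the halves have transforms \<open>a\<close>
  and \<open>b\<close>, rows \<open>r\<close> and \<open>2 ^ j + r\<close> of the next order yield
  \<open>a r + b r\<close> and \<open>a r - b r\<close>, and the parallelogram law adds up their
  squares.\<close>

lemma walsh_parseval:
  "(\<Sum>r<2 ^ j. (\<Sum>i<2 ^ j. walsh j r i * x i)\<^sup>2) = 2 ^ j * (\<Sum>i<2 ^ j. (x i)\<^sup>2)"
proof (induction j arbitrary: x)
  case (Suc j)
  define a b where "a r = (\<Sum>i<2 ^ j. walsh j r i * x i)"
    and "b r = (\<Sum>i<2 ^ j. walsh j r i * x (2 ^ j + i))" for r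
  have split: "sum f {..<2 ^ Suc j} = sum f {..<2 ^ j} + (\<Sum>i<2 ^ j. f (2 ^ j + i))"
    for f :: "nat \<Rightarrow> real"
    using sum_lessThan_add[of f "2 ^ j" "2 ^ j"] by (simp add: mult_2)
  have low: "(\<Sum>i<2 ^ Suc j. walsh (Suc j) r i * x i) = a r + b r" if "r < 2 ^ j" for r
    unfolding split a_def b_def using that by simp
  have high: "(\<Sum>i<2 ^ Suc j. walsh (Suc j) (2 ^ j + r) i * x i) = a r - b r"
    if "r < 2 ^ j" for r
    unfolding split a_def b_def using that by (simp add: sum_negf)
  have "(\<Sum>r<2 ^ Suc j. (\<Sum>i<2 ^ Suc j. walsh (Suc j) r i * x i)\<^sup>2)
      = (\<Sum>r<2 ^ j. (a r + b r)\<^sup>2) + (\<Sum>r<2 ^ j. (a r - b r)\<^sup>2)"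
    unfolding split[of "\<lambda>r. (\<Sum>i<2 ^ Suc j. walsh (Suc j) r i * x i)\<^sup>2"]
    by (intro arg_cong2[where f = "(+)"] sum.cong refl) (simp_all only: low high lessThan_iff)
  also have "\<dots> = 2 * ((\<Sum>r<2 ^ j. (a r)\<^sup>2) + (\<Sum>r<2 ^ j. (b r)\<^sup>2))"
    unfolding sum.distrib[symmetric] sum_distrib_left
    by (intro sum.cong refl) (simp add: power2_eq_square algebra_simps)
  also have "\<dots> = 2 ^ Suc j * ((\<Sum>i<2 ^ j. (x i)\<^sup>2) + (\<Sum>i<2 ^ j. (x (2 ^ j + i))\<^sup>2))"
    using Suc.IH[of x] Suc.IH[of "\<lambda>i. x (2 ^ j + i)"] unfolding a_def b_def
    by (simp add: algebra_simps)
  also have "\<dots> = 2 ^ Suc j * (\<Sum>i<2 ^ Suc j. (x i)\<^sup>2)"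
    unfolding split by simp
  finally show ?case .
qed simp

definition hadamard_mean :: "(nat \<Rightarrow> real) \<Rightarrow> nat \<Rightarrow> real" where
  "hadamard_mean u n = (\<Sum>i<2 ^ floor_log n. walsh (floor_log n) (n - 2 ^ floor_log n) i * u i)
     / 2 ^ floor_log n"

lemma abs_hadamard_mean_le:
  assumes "\<And>i. \<bar>u i\<bar> \<le> M"
  shows "\<bar>hadamard_mean u n\<bar> \<le> M"
proof -
  let ?j = "floor_log n"
  have "\<bar>\<Sum>i<2 ^ ?j. walsh ?j (n - 2 ^ ?j) i * u i\<bar> \<le> (\<Sum>i<(2::nat) ^ ?j. M)"
    using assms by (intro order_trans[OF sum_abs] sum_mono) (simp add: abs_mult)
  then show ?thesis
    by (simp add: hadamard_mean_def divide_le_eq mult.commute)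
qed

text \<open>The range splits into \<open>J\<close> dyadic blocks. In each, Parseval's factor
  \<open>2 ^ j\<close> against the squared divisor leaves the mean of the first \<open>2 ^ j\<close>
  values of \<open>(u i)\<^sup>2\<close>, at most \<open>M\<^sup>2\<close>.\<close>

lemma sum_hadamard_mean_sq_le:
  assumes "\<And>i. \<bar>u i\<bar> \<le> M"
  shows "(\<Sum>n\<in>{1..<2 ^ J}. (hadamard_mean u n)\<^sup>2) \<le> real J * M\<^sup>2"
proof (induction J)
  case (Suc J)
  have "(\<Sum>n\<in>{2 ^ J..<2 ^ Suc J}. (hadamard_mean u n)\<^sup>2)
      = (\<Sum>r<2 ^ J. (hadamard_mean u (2 ^ J + r))\<^sup>2)"
    by (rule sum.reindex_bij_witness[of _ "\<lambda>r. 2 ^ J + r" "\<lambda>n. n - 2 ^ J"]) auto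
  also have "\<dots> = (\<Sum>r<2 ^ J. (\<Sum>i<2 ^ J. walsh J r i * u i)\<^sup>2) / (2 ^ J)\<^sup>2"
  proof -
    have "floor_log (2 ^ J + r) = J" if "r < 2 ^ J" for r
      using that by (intro floor_log_eqI) auto
    then show ?thesis
      by (simp add: hadamard_mean_def power_divide flip: sum_divide_distrib)
  qed
  also have "\<dots> = (\<Sum>i<2 ^ J. (u i)\<^sup>2) / 2 ^ J"
    unfolding walsh_parseval by (simp add: power2_eq_square[of "2 ^ J"])
  also have "\<dots> \<le> (\<Sum>i<(2::nat) ^ J. M\<^sup>2) / 2 ^ J"
    using assms by (intro divide_right_mono sum_mono)
      (auto simp: abs_le_square_iff[symmetric] intro: order_trans[OF _ abs_ge_self])
  also have "\<dots> = M\<^sup>2" by simp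
  finally have "(\<Sum>n\<in>{2 ^ J..<2 ^ Suc J}. (hadamard_mean u n)\<^sup>2) \<le> M\<^sup>2" .
  moreover have "{1..<2 ^ Suc J} = {1..<2 ^ J} \<union> {2 ^ J..<(2::nat) ^ Suc J}"
    by (auto simp: not_less intro: order_trans[of _ "2 ^ J"])
  ultimately show ?case
    using Suc.IH by (simp add: sum.union_disjoint algebra_simps)
qed simp

text \<open>Chebyshev's argument: each exceptional index adds more than
  \<open>\<epsilon>\<^sup>2\<close> to a sum of squares that grows only logarithmically.\<close>

lemma hadamard_mean_converges:
  assumes "\<And>i. \<bar>u i\<bar> \<le> M"
  shows "ideal_converges \<Z> (hadamard_mean u) 0"
  unfolding ideal_converges_def
proof (intro allI impI)
  fix \<epsilon> :: real assume "\<epsilon> > 0"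
  define B where "B = {n \<in> \<nat>\<^sub>+. \<bar>hadamard_mean u n - 0\<bar> > \<epsilon>}"
  have card_B: "real (card (B \<inter> {1..N})) \<le> (log 2 (real N) + 1) * M\<^sup>2 / \<epsilon>\<^sup>2" if "N \<ge> 1" for N
  proof -
    \<comment> \<open>The least exponent with \<open>N < 2 ^ ?J\<close>, so that whole blocks cover
      \<open>{1..N}\<close>.\<close>
    let ?J = "Suc (floor_log N)"
    have "real (card (B \<inter> {1..N})) * \<epsilon>\<^sup>2 = (\<Sum>n\<in>B \<inter> {1..N}. \<epsilon>\<^sup>2)" by simp
    also have "\<dots> \<le> (\<Sum>n\<in>B \<inter> {1..N}. (hadamard_mean u n)\<^sup>2)"
      using \<open>\<epsilon> > 0\<close> by (intro sum_mono) (auto simp: B_def abs_le_square_iff[symmetric])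
    also have "\<dots> \<le> (\<Sum>n\<in>{1..<2 ^ ?J}. (hadamard_mean u n)\<^sup>2)"
      using floor_log_exp2_gt[of N] by (intro sum_mono2) auto
    also have "\<dots> \<le> real ?J * M\<^sup>2"
      by (rule sum_hadamard_mean_sq_le[OF assms])
    also have "\<dots> \<le> (log 2 (real N) + 1) * M\<^sup>2"
    proof -
      have "real (2 ^ floor_log N) \<le> real N"
        using floor_log_exp2_le[of N] that by (simp only: of_nat_le_iff)
      then have "real (floor_log N) \<le> log 2 (real N)"
        using that by (simp add: le_log_iff powr_realpow)
      then show ?thesis by (intro mult_right_mono) auto
    qed
    finally show ?thesis
      using \<open>\<epsilon> > 0\<close> by (simp add: pos_le_divide_eq)
  qed
  have "(\<lambda>N. real (card (B \<inter> {1..N})) / real N) \<longlonglongrightarrow> 0"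
  proof (rule tendsto_sandwich[OF _ _ tendsto_const])
    have "(\<lambda>N. (log 2 (real N) + 1) / real N) \<longlonglongrightarrow> 0"
      by real_asymp
    from tendsto_mult_right_zero[OF this, of "M\<^sup>2 / \<epsilon>\<^sup>2"]
    show "(\<lambda>N. ((log 2 (real N) + 1) * M\<^sup>2 / \<epsilon>\<^sup>2) / real N) \<longlonglongrightarrow> 0"
      by (simp add: field_simps)
    show "\<forall>\<^sub>F N in sequentially. real (card (B \<inter> {1..N})) / real N
        \<le> ((log 2 (real N) + 1) * M\<^sup>2 / \<epsilon>\<^sup>2) / real N"
      using eventually_ge_at_top[of 1]
      by eventually_elim (intro divide_right_mono card_B, auto)
  qed auto
  then show "{n \<in> \<nat>\<^sub>+. \<bar>hadamard_mean u n - 0\<bar> > \<epsilon>} \<in> \<Z>"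
    by (auto simp: density_zero_def B_def)
qed

section \<open>The matrix\<close>

text \<open>Dropping the diagonal entry for \<open>n \<in> E\<close> leaves only Hadamard entries in
  the columns of \<open>E\<close>. For infinite \<open>E\<close> at most one \<open>i\<close>
  contributes to the sum, as \<open>enumerate E\<close> is injective.\<close>

definition walsh_matrix :: "nat set \<Rightarrow> nat \<Rightarrow> nat \<Rightarrow> real" where
  "walsh_matrix E n k = (if k = n \<and> n \<notin> E then 1 else 0) +
     (\<Sum>i<2 ^ floor_log n. if k = enumerate E i
        then walsh (floor_log n) (n - 2 ^ floor_log n) i / 2 ^ floor_log n else 0)"

lemma sums_Suc_single:
  fixes c :: real
  assumes "m \<ge> 1"
  shows "(\<lambda>k. (if Suc k = m then c else 0) * x (Suc k)) sums (c * x m)"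
proof -
  obtain l where m: "m = Suc l" using assms by (cases m) auto
  have "(\<lambda>k. if k = l then c * x (Suc k) else 0) sums (c * x (Suc l))"
    by (rule sums_single)
  moreover have "(\<lambda>k. if k = l then c * x (Suc k) else 0)
      = (\<lambda>k. (if Suc k = m then c else 0) * x (Suc k))"
    by (auto simp: m)
  ultimately show ?thesis by (simp only: m)
qed

text \<open>Each row is a finite combination of unit vectors, so its series converges for every
  \<open>x\<close>.\<close>

lemma walsh_matrix_sums:
  assumes "infinite E" "E \<subseteq> \<nat>\<^sub>+" "n \<in> \<nat>\<^sub>+"
  shows "(\<lambda>k. walsh_matrix E n (Suc k) * x (Suc k)) sums
    ((if n \<in> E then 0 else x n) + hadamard_mean (\<lambda>i. x (enumerate E i)) n)"
proof -
  let ?w = "\<lambda>i. walsh (floor_log n) (n - 2 ^ floor_log n) i / 2 ^ floor_log n"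
  \<comment> \<open>The series starts at column 1, so an entry in column 0 would be lost.\<close>
  have pos: "enumerate E i \<ge> 1" for i
    using enumerate_in_set[OF assms(1), of i] assms(2) by auto
  have "(\<lambda>k. (if Suc k = n then (if n \<in> E then 0 else 1) else 0) * x (Suc k)
      + (\<Sum>i<2 ^ floor_log n. (if Suc k = enumerate E i then ?w i else 0) * x (Suc k)))
    sums ((if n \<in> E then 0 else 1) * x n + (\<Sum>i<2 ^ floor_log n. ?w i * x (enumerate E i)))"
    using assms(3) pos by (intro sums_add sums_sum sums_Suc_single) auto
  moreover have "(\<lambda>k. (if Suc k = n then (if n \<in> E then 0 else 1) else 0) * x (Suc k)
      + (\<Sum>i<2 ^ floor_log n. (if Suc k = enumerate E i then ?w i else 0) * x (Suc k)))
    = (\<lambda>k. walsh_matrix E n (Suc k) * x (Suc k))"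
    by (intro ext) (simp add: walsh_matrix_def distrib_right sum_distrib_right)
  ultimately show ?thesis
    by (simp add: hadamard_mean_def sum_divide_distrib if_distrib[of "\<lambda>t. t * _"] cong: if_cong)
qed

text \<open>On \<open>E\<close> the diagonal part vanishes; what remains is
  \<open>2 ^ floor_log n\<close> distinct columns, each with an entry of modulus
  \<open>1 / 2 ^ floor_log n\<close>.\<close>

lemma infsum_abs_walsh_matrix:
  assumes "infinite E"
  shows "(\<Sum>\<^sub>\<infinity>k\<in>E. \<bar>walsh_matrix E n k\<bar>) = 1"
proof -
  let ?j = "floor_log n"
  let ?F = "enumerate E ` {..<2 ^ ?j}"
  have inj: "inj (enumerate E)"
    using bij_enumerate[OF assms] by (rule bij_betw_imp_inj_on)
  have val: "walsh_matrix E n (enumerate E i) = (if i < 2 ^ ?j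
      then walsh ?j (n - 2 ^ ?j) i / 2 ^ ?j else 0)" for i
    using enumerate_in_set[OF assms, of i]
    by (auto simp: walsh_matrix_def inj_eq[OF inj])
  have "(\<Sum>\<^sub>\<infinity>k\<in>E. \<bar>walsh_matrix E n k\<bar>) = (\<Sum>\<^sub>\<infinity>k\<in>?F. \<bar>walsh_matrix E n k\<bar>)"
  proof (rule infsum_cong_neutral)
    fix k assume "k \<in> E - ?F"
    then obtain i where "k = enumerate E i" "\<not> i < 2 ^ ?j"
      using enumerate_Ex[OF assms, of k] by fastforce
    then show "\<bar>walsh_matrix E n k\<bar> = 0" by (simp add: val)
  qed (use enumerate_in_set[OF assms] in auto)
  also have "\<dots> = (\<Sum>i<2 ^ ?j. \<bar>walsh_matrix E n (enumerate E i)\<bar>)"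
    by (simp add: sum.reindex inj_on_subset[OF inj])
  also have "\<dots> = 1" by (simp add: val)
  finally show ?thesis .
qed

lemma walsh_matrix_limit:
  assumes "infinite E" "E \<in> \<Z>" "\<I> \<subseteq> \<Z>" "x \<in> ell_infty" "ideal_converges \<I> x \<eta>"
  shows "mat_defined (walsh_matrix E) x"
    and "mat_apply (walsh_matrix E) x \<in> ell_infty"
    and "ideal_converges \<Z> (mat_apply (walsh_matrix E) x) \<eta>"
proof -
  have E: "E \<subseteq> \<nat>\<^sub>+" using assms(2) by (simp add: density_zero_def)
  define u where "u i = x (enumerate E i)" for i
  obtain M where M: "\<And>n. n \<in> \<nat>\<^sub>+ \<Longrightarrow> \<bar>x n\<bar> \<le> M"
    using assms(4) unfolding ell_infty_def by (auto simp: bounded_iff)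
  have u: "\<bar>u i\<bar> \<le> M" for i
    unfolding u_def using enumerate_in_set[OF assms(1), of i] E by (intro M) auto
  note sums = walsh_matrix_sums[OF assms(1) E, of _ x, folded u_def]
  have apply_eq: "mat_apply (walsh_matrix E) x n = (if n \<in> E then 0 else x n) + hadamard_mean u n"
    if "n \<in> \<nat>\<^sub>+" for n
    using sums[OF that] by (simp add: mat_apply_def sums_iff)
  show "mat_defined (walsh_matrix E) x"
    using sums by (auto simp: mat_defined_def sums_iff)
  \<comment> \<open>The diagonal part and the Hadamard part contribute at most \<open>M\<close>
    each.\<close>
  have "\<bar>mat_apply (walsh_matrix E) x n\<bar> \<le> 2 * M" if "n \<in> \<nat>\<^sub>+" for n
    using M[OF that] abs_hadamard_mean_le[of u M n] u unfolding apply_eq[OF that] by auto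
  then show "mat_apply (walsh_matrix E) x \<in> ell_infty"
    unfolding ell_infty_def bounded_iff by auto
  show "ideal_converges \<Z> (mat_apply (walsh_matrix E) x) \<eta>"
    unfolding ideal_converges_def
  proof (intro allI impI)
    fix \<epsilon> :: real assume "\<epsilon> > 0"
    \<comment> \<open>Off \<open>E\<close> the error is \<open>x n - \<eta>\<close> plus the
      Hadamard mean, so one of the two must exceed half of \<open>\<epsilon>\<close>.\<close>
    let ?U = "E \<union> {n \<in> \<nat>\<^sub>+. \<bar>x n - \<eta>\<bar> > \<epsilon> / 2} \<union> {n \<in> \<nat>\<^sub>+. \<bar>hadamard_mean u n - 0\<bar> > \<epsilon> / 2}"
    have "{n \<in> \<nat>\<^sub>+. \<bar>x n - \<eta>\<bar> > \<epsilon> / 2} \<in> \<I>"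
      using assms(5) \<open>\<epsilon> > 0\<close> unfolding ideal_converges_def by (meson half_gt_zero)
    moreover have "{n \<in> \<nat>\<^sub>+. \<bar>hadamard_mean u n - 0\<bar> > \<epsilon> / 2} \<in> \<Z>"
      using hadamard_mean_converges[of u M] u \<open>\<epsilon> > 0\<close> unfolding ideal_converges_def
      by (meson half_gt_zero)
    ultimately have "?U \<in> \<Z>"
      using assms(2,3) by (intro density_zero_Un) auto
    moreover have "{n \<in> \<nat>\<^sub>+. \<bar>mat_apply (walsh_matrix E) x n - \<eta>\<bar> > \<epsilon>} \<subseteq> ?U"
    proof
      fix n assume n: "n \<in> {n \<in> \<nat>\<^sub>+. \<bar>mat_apply (walsh_matrix E) x n - \<eta>\<bar> > \<epsilon>}"
      then have "n \<in> \<nat>\<^sub>+" by simp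
      show "n \<in> ?U"
      proof (cases "n \<in> E")
        case False
        then have "\<epsilon> < \<bar>x n + hadamard_mean u n - \<eta>\<bar>"
          using n apply_eq[OF \<open>n \<in> \<nat>\<^sub>+\<close>] by simp
        then have "\<epsilon> / 2 < \<bar>x n - \<eta>\<bar> \<or> \<epsilon> / 2 < \<bar>hadamard_mean u n - 0\<bar>"
          by linarith
        then show ?thesis
          using \<open>n \<in> \<nat>\<^sub>+\<close> by blast
      qed simp
    qed
    ultimately show "{n \<in> \<nat>\<^sub>+. \<bar>mat_apply (walsh_matrix E) x n - \<eta>\<bar> > \<epsilon>} \<in> \<Z>"
      by (rule density_zero_subset)
  qed
qed

theorem theorem1p4:
  fixes \<I> :: "nat set set"
  assumes "ideal_on_pos \<I>"
    and "Fin \<subset> \<I>"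
    and "\<I> \<subseteq> \<Z>"
  shows "\<exists>A :: nat \<Rightarrow> nat \<Rightarrow> real.
           ideal_regular \<I> \<Z> A \<and>
           \<not> (\<forall>E\<in>\<I>. ideal_converges \<Z> (\<lambda>n. \<Sum>\<^sub>\<infinity>k\<in>E. \<bar>A n k\<bar>) 0)"
proof -
  obtain E where E: "E \<in> \<I>" "E \<notin> Fin"
    using assms(2) by auto
  then have "E \<in> \<Z>" using assms(3) by auto
  \<comment> \<open>\<open>E \<in> \<Z>\<close> includes
    \<open>E \<subseteq> \<nat>\<^sub>+\<close>, so only infinitude can keep \<open>E\<close> out of
    \<open>Fin\<close>.\<close>
  then have inf: "infinite E"
    using E(2) by (auto simp: Fin_def density_zero_def)
  note limit = walsh_matrix_limit[OF inf \<open>E \<in> \<Z>\<close> assms(3)]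
  \<comment> \<open>For the converse of limit preservation, \<open>x\<close> has some limit, which
    passes to its transform; uniqueness identifies it with the given one.\<close>
  have "ideal_regular \<I> \<Z> (walsh_matrix E)"
    unfolding ideal_regular_def mat_class_def c_space_def
    using limit ideal_converges_density_zero_unique by blast
  moreover have "\<not> ideal_converges \<Z> (\<lambda>n. \<Sum>\<^sub>\<infinity>k\<in>E. \<bar>walsh_matrix E n k\<bar>) 0"
  proof
    assume "ideal_converges \<Z> (\<lambda>n. \<Sum>\<^sub>\<infinity>k\<in>E. \<bar>walsh_matrix E n k\<bar>) 0"
    \<comment> \<open>The row sums over \<open>E\<close> are constantly 1, so 0 would be a second
      limit.\<close>
    moreover have "ideal_converges \<Z> (\<lambda>n. 1) 1"
      by (simp add: ideal_converges_def density_zero_def)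
    ultimately show False
      using ideal_converges_density_zero_unique
      by (simp add: infsum_abs_walsh_matrix[OF inf]) fastforce
  qed
  ultimately show ?thesis using E(1) by blast
qed

end
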